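(* Let $\mathcal{P}$ be a hereditary graph property, and suppose that $L \notin \mathcal{P}$ for some bipartite graph $L$. Then there exists $\varepsilon = \varepsilon(L) > 0$ such that for every fixed $p \in (0,1)$, with probability tending to $1$ as $n \to \infty$, \[ \operatorname{ex}(G(n,p),\mathcal{P}) \le n^{2-\varepsilon}. \]
   Context: $G(n,p)$ denotes the Erdős–Rényi random graph on vertex set $[n]=\{1,\dots,n\}$ in which each pair of vertices is an edge independently with probability $p$. A hereditary property $\mathcal{P}$ is a collection of graphs closed under isomorphism and under taking induced subgraphs (if $G \in \mathcal{P}$ then $G[S] \in \mathcal{P}$ for all $S \subseteq V(G)$); it is assumed that every hereditary property contains all edgeless graphs. For a graph $G$, $\operatorname{ex}(G,\mathcal{P})$ denotes the maximum number of edges of a subgraph of $G$ that belongs to $\mathcal{P}$. *)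

theory Defs
  imports "HOL-Library.Ramsey" "HOL-Probability.Probability"
begin

type_synonym 'a ugraph = "'a set \<times> 'a set set"

abbreviation verts :: "'a ugraph \<Rightarrow> 'a set" where "verts G \<equiv> fst G"
abbreviation edges :: "'a ugraph \<Rightarrow> 'a set set" where "edges G \<equiv> snd G"

definition finite_graph :: "'a ugraph \<Rightarrow> bool" where
  "finite_graph G \<longleftrightarrow> finite (verts G) \<and> edges G \<subseteq> nsets (verts G) 2"

definition isomorphic :: "'a ugraph \<Rightarrow> 'b ugraph \<Rightarrow> bool" where
  "isomorphic G H \<longleftrightarrow>
     (\<exists>f. bij_betw f (verts G) (verts H) \<and>
          (\<forall>x\<in>verts G. \<forall>y\<in>verts G. {x, y} \<in> edges G \<longleftrightarrow> {f x, f y} \<in> edges H))"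

definition subgraph :: "'a ugraph \<Rightarrow> 'a ugraph \<Rightarrow> bool" where
  "subgraph H G \<longleftrightarrow> finite_graph H \<and> verts H \<subseteq> verts G \<and> edges H \<subseteq> edges G"

definition induced :: "'a ugraph \<Rightarrow> 'a set \<Rightarrow> 'a ugraph" where
  "induced G S = (S, {e \<in> edges G. e \<subseteq> S})"

definition bipartite :: "'a ugraph \<Rightarrow> bool" where
  "bipartite G \<longleftrightarrow>
     (\<exists>A B. A \<union> B = verts G \<and> A \<inter> B = {} \<and>
            (\<forall>e\<in>edges G. \<exists>a\<in>A. \<exists>b\<in>B. e = {a, b}))"

text \<open>The last conjunct is the convention that every hereditary property contains all edgeless
  graphs.\<close>

definition hereditary_property :: "'a ugraph set \<Rightarrow> bool" where
  "hereditary_property P \<longleftrightarrow>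
     (\<forall>G\<in>P. finite_graph G) \<and>
     (\<forall>G\<in>P. \<forall>H. finite_graph H \<and> isomorphic G H \<longrightarrow> H \<in> P) \<and>
     (\<forall>G\<in>P. \<forall>S\<subseteq>verts G. induced G S \<in> P) \<and>
     (\<forall>V. finite V \<longrightarrow> (V, {}) \<in> P)"

definition ex_num :: "'a ugraph \<Rightarrow> 'a ugraph set \<Rightarrow> nat" where
  "ex_num G P = Max {card (edges H) | H. subgraph H G \<and> H \<in> P}"

definition gnp :: "nat \<Rightarrow> real \<Rightarrow> nat ugraph pmf" where
  "gnp n p =
     map_pmf (\<lambda>X. ({1..n}, {e \<in> nsets {1..n} 2. X e}))
       (Pi_pmf (nsets {1..n} 2) False (\<lambda>_. bernoulli_pmf p))"

text \<open>The maximum defining \<^const>\<open>ex_num\<close> is taken over a finite nonempty set.\<close>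

lemma ex_num_set_finite_nonempty:
  assumes "finite_graph G" and "hereditary_property P"
  shows "finite {card (edges H) | H. subgraph H G \<and> H \<in> P}"
    and "{card (edges H) | H. subgraph H G \<and> H \<in> P} \<noteq> {}"
proof -
  have "finite (edges G)"
    using assms(1) finite_imp_finite_nsets finite_subset unfolding finite_graph_def by blast
  then have "{card (edges H) | H. subgraph H G \<and> H \<in> P} \<subseteq> {..card (edges G)}"
    by (auto simp: subgraph_def intro: card_mono)
  then show "finite {card (edges H) | H. subgraph H G \<and> H \<in> P}"
    using finite_subset by blast
  have "subgraph ({}, {}) G" "({}, {}) \<in> P"
    using assms(2) by (auto simp: subgraph_def finite_graph_def hereditary_property_def)
  then show "{card (edges H) | H. subgraph H G \<and> H \<in> P} \<noteq> {}"
    by blast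
qed

end

theory Submission
  imports Defs "HOL-Real_Asymp.Real_Asymp"
begin

text \<open>
  The only property of \<open>G(n,p)\<close> that matters is that with high probability it contains no
  \<open>K\<^bsub>z,z\<^esub>\<close> with \<open>z = n\<^bsup>\<delta>\<^esup>\<close>, hence neither does any subgraph \<open>H\<close>. In a graph without
  \<open>K\<^bsub>z,z\<^esub>\<close>, all but fewer than \<open>z\<close> vertices have about \<open>|W| / z\<^sup>2\<close> non-neighbours in a given set
  \<open>W\<close>, so non-adjacency is available at the cost of a factor \<open>z\<^sup>3\<close>. If \<open>H\<close> has \<open>n\<^bsup>2-\<epsilon>\<^esup>\<close> edges,
  dependent random choice gives a large set \<open>U\<close> in which any \<open>a\<close> vertices have many common
  neighbours, where \<open>a\<close> is the size of one side of \<open>L\<close>. A fraction of at least \<open>z\<^bsup>-3a\<^sup>2\<^esup>\<close> of the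
  maps from that side into \<open>U\<close> have independent images, whereas a much smaller fraction of all maps
  hit one of the few exceptional vertices of an adjacency pattern given by the other values. So there
  are independent vertices \<open>R\<close> in \<open>U\<close> such that every adjacency pattern on \<open>R\<close> is realised by many
  vertices of \<open>H\<close>, and an independent choice among these embeds the other side of \<open>L\<close>.
\<close>

section \<open>Counting lemmas\<close>

lemma choose_le_power: "n choose k \<le> n ^ k"
  by (cases "k \<le> n") (simp_all add: binomial_le_pow binomial_eq_0)

lemma sum_power_le_sum_of_powers:
  fixes f :: "'a \<Rightarrow> nat"
  assumes "0 < t"
  shows "(\<Sum>x\<in>A. f x) ^ t \<le> card A ^ (t - 1) * (\<Sum>x\<in>A. f x ^ t)"
proof (cases "finite A \<and> A \<noteq> {}")
  case True
  then have card_pos: "0 < real (card A)" by (simp add: card_gt_0_iff)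
  have "convex_on {0::real..} (\<lambda>x. x ^ t)"
    by (cases "even t") (auto intro: convex_power_odd convex_on_subset[OF convex_power_even])
  then have "(\<Sum>x\<in>A. (1 / card A) *\<^sub>R real (f x)) ^ t \<le> (\<Sum>x\<in>A. (1 / card A) * real (f x) ^ t)"
    using True by (intro convex_on_sum) auto
  then have "((\<Sum>x\<in>A. real (f x)) / card A) ^ t \<le> (\<Sum>x\<in>A. real (f x) ^ t) / card A"
    by (simp add: sum_divide_distrib)
  moreover have "real (card A) ^ t = real (card A) ^ (t - 1) * card A"
    using power_minus_mult[OF assms] by metis
  ultimately have "(\<Sum>x\<in>A. real (f x)) ^ t \<le> real (card A) ^ (t - 1) * (\<Sum>x\<in>A. real (f x) ^ t)"
    using card_pos by (simp add: power_divide field_simps)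
  then show ?thesis
    by (simp flip: of_nat_sum of_nat_power of_nat_mult)
qed (use assms in auto)

lemma exists_subset_containing_none:
  assumes "finite A" "finite \<F>" "{} \<notin> \<F>"
  shows "\<exists>U\<subseteq>A. card A \<le> card U + card \<F> \<and> (\<forall>S\<in>\<F>. \<not> S \<subseteq> U)"
proof -
  obtain pick where pick: "\<And>S. S \<in> \<F> \<Longrightarrow> pick S \<in> S"
    using assms(3) by (metis all_not_in_conv)
  have "card A - card (pick ` \<F>) \<le> card (A - pick ` \<F>)"
    using assms(2) by (intro diff_card_le_card_Diff) simp
  moreover have "card (pick ` \<F>) \<le> card \<F>"
    using assms(2) by (rule card_image_le)
  ultimately have "card A \<le> card (A - pick ` \<F>) + card \<F>" by linarith
  then show ?thesis using pick by (intro exI[of _ "A - pick ` \<F>"]) auto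
qed

abbreviation lists_of_length :: "'a set \<Rightarrow> nat \<Rightarrow> 'a list set" where
  "lists_of_length V t \<equiv> {xs. set xs \<subseteq> V \<and> length xs = t}"

lemma sum_lists_card_containing:
  assumes "finite V" "finite J" "\<And>j. j \<in> J \<Longrightarrow> W j \<subseteq> V"
  shows "(\<Sum>xs\<in>lists_of_length V t. card {j \<in> J. set xs \<subseteq> W j})
    = (\<Sum>j\<in>J. card (W j) ^ t)"
proof (rule sum_multicount_gen)
  show "\<forall>j\<in>J. card {xs \<in> lists_of_length V t. set xs \<subseteq> W j} = card (W j) ^ t"
  proof
    fix j assume "j \<in> J"
    then have "W j \<subseteq> V" by (rule assms(3))
    then have "{xs \<in> lists_of_length V t. set xs \<subseteq> W j} = lists_of_length (W j) t" by auto
    with \<open>W j \<subseteq> V\<close> show "card {xs \<in> lists_of_length V t. set xs \<subseteq> W j} = card (W j) ^ t"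
      using assms(1) by (simp add: card_lists_length_eq finite_subset)
  qed
qed (use assms finite_lists_length_eq in auto)

lemma card_PiE_hit_le:
  assumes "finite U" "finite I" "j \<in> I"
    and indep: "\<And>f x. D (f(j := x)) = D f"
    and bound: "\<And>f. card (D f \<inter> U) \<le> c"
  shows "card {f \<in> I \<rightarrow>\<^sub>E U. f j \<in> D f} \<le> c * card U ^ (card I - 1)"
proof -
  let ?hit = "{f \<in> I \<rightarrow>\<^sub>E U. f j \<in> D f}"
  let ?rest = "(I - {j}) \<rightarrow>\<^sub>E U"
  let ?split = "\<lambda>f. (f(j := undefined), f j)"
  have finite_rest: "finite ?rest" using assms by (intro finite_PiE) auto
  have "inj_on ?split ?hit"
  proof (rule inj_onI)
    fix f g assume "?split f = ?split g"
    then have "(f(j := undefined))(j := f j) = (g(j := undefined))(j := g j)" by simp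
    then show "f = g" by simp
  qed
  moreover have "?split ` ?hit \<subseteq> Sigma ?rest (\<lambda>g. D g \<inter> U)"
    using indep \<open>j \<in> I\<close> by (auto simp: PiE_iff extensional_def split: if_splits)
  ultimately have "card ?hit \<le> card (Sigma ?rest (\<lambda>g. D g \<inter> U))"
    using finite_rest assms(1) by (intro card_inj_on_le[of ?split]) auto
  also have "\<dots> = (\<Sum>g\<in>?rest. card (D g \<inter> U))"
    using finite_rest assms(1) by (intro card_SigmaI) auto
  also have "\<dots> \<le> (\<Sum>g\<in>?rest. c)"
    by (intro sum_mono bound)
  also have "\<dots> = c * card U ^ (card I - 1)"
    using assms(2,3) by (simp add: card_PiE)
  finally show ?thesis .
qed

section \<open>Dependent random choice\<close>

locale fin_graph =
  fixes G :: "'a ugraph"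
  assumes finite_graph: "finite_graph G"
begin

definition neighbours :: "'a \<Rightarrow> 'a set" where
  "neighbours x = {y \<in> verts G. {x, y} \<in> edges G}"

definition non_neighbours :: "'a \<Rightarrow> 'a set" where
  "non_neighbours x = {y \<in> verts G. y \<noteq> x \<and> {x, y} \<notin> edges G}"

abbreviation independent_family :: "('b \<Rightarrow> 'a) \<Rightarrow> 'b set \<Rightarrow> bool" where
  "independent_family g I \<equiv> pairwise (\<lambda>i j. g j \<in> non_neighbours (g i)) I"

abbreviation independent :: "'a set \<Rightarrow> bool" where
  "independent R \<equiv> independent_family (\<lambda>x. x) R"

definition witnesses :: "'a set \<Rightarrow> 'a set \<Rightarrow> 'a set" where
  "witnesses S T = {w \<in> verts G. S \<subseteq> neighbours w \<and> T \<subseteq> non_neighbours w}"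

abbreviation common_neighbours :: "'a set \<Rightarrow> 'a set" where
  "common_neighbours S \<equiv> witnesses S {}"

lemma finite_verts: "finite (verts G)"
  using finite_graph by (simp add: finite_graph_def)

lemma edges_subset: "edges G \<subseteq> nsets (verts G) 2"
  using finite_graph by (simp add: finite_graph_def)

lemma no_loop: "{x, x} \<notin> edges G"
  using edges_subset by (auto simp: nsets_def)

lemma neighbours_subset: "neighbours x \<subseteq> verts G"
  by (auto simp: neighbours_def)

lemma neighbours_sym: "y \<in> neighbours x \<longleftrightarrow> x \<in> neighbours y"
  using edges_subset by (auto simp: neighbours_def insert_commute)

lemma non_neighbours_sym:
  "x \<in> verts G \<Longrightarrow> y \<in> verts G \<Longrightarrow> y \<in> non_neighbours x \<longleftrightarrow> x \<in> non_neighbours y"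
  by (auto simp: non_neighbours_def insert_commute)

lemma witnesses_subset: "witnesses S T \<subseteq> verts G"
  by (auto simp: witnesses_def)

lemma finite_witnesses: "finite (witnesses S T)"
  using finite_subset[OF witnesses_subset finite_verts] .

lemma witnesses_insert_right:
  "x \<in> verts G \<Longrightarrow> witnesses S (insert x T) = witnesses S T \<inter> non_neighbours x"
  using non_neighbours_sym by (auto simp: witnesses_def non_neighbours_def)

lemma subset_common_neighbours_sym:
  assumes "S \<subseteq> verts G" "T \<subseteq> verts G"
  shows "S \<subseteq> common_neighbours T \<longleftrightarrow> T \<subseteq> common_neighbours S"
  using assms neighbours_sym unfolding witnesses_def by blast

lemma card_edges_le_sum_degrees: "card (edges G) \<le> (\<Sum>x\<in>verts G. card (neighbours x))"
proof -
  have "edges G \<subseteq> (\<lambda>(x, y). {x, y}) ` Sigma (verts G) neighbours"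
  proof
    fix e assume "e \<in> edges G"
    moreover then obtain x y where "e = {x, y}" "x \<in> verts G" "y \<in> verts G"
      using edges_subset nsets2_E by blast
    ultimately show "e \<in> (\<lambda>(x, y). {x, y}) ` Sigma (verts G) neighbours"
      by (auto simp: neighbours_def intro!: image_eqI[of _ _ "(x, y)"])
  qed
  moreover have "finite (neighbours x)" for x
    using finite_subset[OF neighbours_subset finite_verts] .
  ultimately have "card (edges G) \<le> card (Sigma (verts G) neighbours)"
    using finite_verts by (intro surj_card_le) auto
  then show ?thesis
    using finite_verts \<open>\<And>x. finite (neighbours x)\<close> by simp
qed

definition poor_subsets :: "nat \<Rightarrow> nat \<Rightarrow> 'a set set" where
  "poor_subsets s m = {S. S \<subseteq> verts G \<and> card S = s \<and> card (common_neighbours S) < m}"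

lemma finite_poor_subsets: "finite (poor_subsets s m)"
  using finite_verts by (simp add: poor_subsets_def)

lemma sum_card_common_neighbours_lists:
  "(\<Sum>xs\<in>lists_of_length (verts G) t. card (common_neighbours (set xs)))
    = (\<Sum>x\<in>verts G. card (neighbours x) ^ t)"
  using sum_lists_card_containing[OF finite_verts finite_verts neighbours_subset]
  by (simp add: witnesses_def)

lemma sum_card_poor_subsets_lists_le:
  "(\<Sum>xs\<in>lists_of_length (verts G) t. card {S \<in> poor_subsets s m. S \<subseteq> common_neighbours (set xs)})
    \<le> (card (verts G) choose s) * m ^ t" (is "(\<Sum>xs\<in>?lists. _) \<le> _")
proof -
  have "{S \<in> poor_subsets s m. S \<subseteq> common_neighbours (set xs)}
      = {S \<in> poor_subsets s m. set xs \<subseteq> common_neighbours S}" if "xs \<in> ?lists" for xs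
    using that subset_common_neighbours_sym by (auto simp: poor_subsets_def)
  then have "(\<Sum>xs\<in>?lists. card {S \<in> poor_subsets s m. S \<subseteq> common_neighbours (set xs)})
      = (\<Sum>S\<in>poor_subsets s m. card (common_neighbours S) ^ t)"
    using sum_lists_card_containing[OF finite_verts finite_poor_subsets witnesses_subset] by simp
  also have "\<dots> \<le> (\<Sum>S\<in>poor_subsets s m. m ^ t)"
    by (intro sum_mono power_mono) (auto simp: poor_subsets_def)
  also have "\<dots> = card (poor_subsets s m) * m ^ t" by simp
  also have "card (poor_subsets s m) \<le> card {S. S \<subseteq> verts G \<and> card S = s}"
    using finite_verts by (intro card_mono) (auto simp: poor_subsets_def)
  also have "\<dots> = card (verts G) choose s"
    using finite_verts by (rule n_subsets)
  finally show ?thesis by simp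
qed

lemma exists_list_few_poor_subsets:
  assumes "verts G \<noteq> {}"
    and average: "a * card (verts G) ^ t + (card (verts G) choose s) * m ^ t
      \<le> (\<Sum>x\<in>verts G. card (neighbours x) ^ t)"
  shows "\<exists>xs. a + card {S \<in> poor_subsets s m. S \<subseteq> common_neighbours (set xs)}
    \<le> card (common_neighbours (set xs))" (is "\<exists>xs. a + ?poor xs \<le> ?common xs")
proof (rule ccontr)
  let ?lists = "lists_of_length (verts G) t"
  assume "\<not> ?thesis"
  then have few: "?common xs < a + ?poor xs" for xs by (meson not_le)
  have finite_lists: "finite ?lists"
    using finite_verts by (rule finite_lists_length_eq)
  obtain v where "v \<in> verts G" using assms(1) by blast
  then have "replicate t v \<in> ?lists" by auto
  then have "?lists \<noteq> {}" by blast
  with finite_lists have "(\<Sum>xs\<in>?lists. ?common xs) < (\<Sum>xs\<in>?lists. a + ?poor xs)"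
    using few by (rule sum_strict_mono)
  also have "\<dots> = a * card (verts G) ^ t + (\<Sum>xs\<in>?lists. ?poor xs)"
    using finite_verts by (simp add: sum.distrib card_lists_length_eq)
  also have "\<dots> \<le> (\<Sum>xs\<in>?lists. ?common xs)"
    using average sum_card_poor_subsets_lists_le[where s = s and m = m and t = t]
    unfolding sum_card_common_neighbours_lists by linarith
  finally show False by simp
qed

lemma dependent_random_choice:
  assumes "verts G \<noteq> {}" "0 < s"
    and "a * card (verts G) ^ t + (card (verts G) choose s) * m ^ t
      \<le> (\<Sum>x\<in>verts G. card (neighbours x) ^ t)"
  shows "\<exists>U\<subseteq>verts G. a \<le> card U \<and> (\<forall>S\<subseteq>U. card S = s \<longrightarrow> m \<le> card (common_neighbours S))"
proof -
  let ?common = "\<lambda>xs. common_neighbours (set xs)"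
  let ?poor = "\<lambda>xs. {S \<in> poor_subsets s m. S \<subseteq> ?common xs}"
  obtain xs where xs: "a + card (?poor xs) \<le> card (?common xs)"
    using exists_list_few_poor_subsets[OF assms(1,3)] by (elim exE)
  have "finite (?poor xs)" using finite_poor_subsets by simp
  moreover have "{} \<notin> ?poor xs" using \<open>0 < s\<close> by (simp add: poor_subsets_def)
  ultimately have "\<exists>U\<subseteq>?common xs. card (?common xs) \<le> card U + card (?poor xs) \<and>
      (\<forall>S\<in>?poor xs. \<not> S \<subseteq> U)"
    by (rule exists_subset_containing_none[OF finite_witnesses])
  then obtain U where U: "U \<subseteq> ?common xs" "card (?common xs) \<le> card U + card (?poor xs)"
      and U_rich: "\<forall>S\<in>?poor xs. \<not> S \<subseteq> U"
    by (elim exE conjE)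
  show ?thesis
  proof (intro exI[of _ U] conjI allI impI)
    show "U \<subseteq> verts G" using U(1) witnesses_subset by blast
    show "a \<le> card U" using U(2) xs by linarith
    fix S assume S: "S \<subseteq> U" "card S = s"
    have "S \<subseteq> ?common xs" using S(1) U(1) by (rule subset_trans)
    moreover from this have "S \<notin> poor_subsets s m" using S(1) U_rich by auto
    ultimately show "m \<le> card (common_neighbours S)"
      using S(2) subset_trans[OF _ witnesses_subset] by (simp add: poor_subsets_def not_less)
  qed
qed

lemma sum_degree_powers_ge:
  assumes "0 < z" "0 < s" "0 < K"
    and card_verts: "card (verts G) \<le> z ^ K" and card_edges: "z ^ (2 * K - 1) \<le> card (edges G)"
  shows "z ^ (K * s + K - s) \<le> (\<Sum>x\<in>verts G. card (neighbours x) ^ s)" (is "_ \<le> ?sum")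
proof -
  have "K * (s - 1) + (K * s + K - s) = (2 * K - 1) * s"
    using \<open>0 < s\<close> \<open>0 < K\<close> by (cases s; cases K) (simp_all add: algebra_simps)
  then have "z ^ (K * (s - 1)) * z ^ (K * s + K - s) = (z ^ (2 * K - 1)) ^ s"
    by (simp only: flip: power_add power_mult)
  also have "\<dots> \<le> (\<Sum>x\<in>verts G. card (neighbours x)) ^ s"
    using card_edges card_edges_le_sum_degrees by (intro power_mono) auto
  also have "\<dots> \<le> card (verts G) ^ (s - 1) * ?sum"
    using \<open>0 < s\<close> by (rule sum_power_le_sum_of_powers)
  also have "\<dots> \<le> z ^ (K * (s - 1)) * ?sum"
    using card_verts by (simp add: power_mono power_mult)
  finally show ?thesis using \<open>0 < z\<close> by simp
qed

lemma dependent_random_choice_dense: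
  fixes z M s :: nat
  defines "K \<equiv> (M + 1) * (s + 1)"
  assumes "2 \<le> z" "0 < s"
    and card_verts: "card (verts G) \<le> z ^ K" and card_edges: "z ^ (2 * K - 1) \<le> card (edges G)"
  shows "\<exists>U\<subseteq>verts G. z ^ M \<le> card U \<and> (\<forall>S\<subseteq>U. card S = s \<longrightarrow> z ^ M \<le> card (common_neighbours S))"
proof (rule dependent_random_choice)
  let ?n = "card (verts G)"
  have "0 < card (edges G)" using \<open>2 \<le> z\<close> by (intro less_le_trans[OF _ card_edges]) simp
  then show "verts G \<noteq> {}" using edges_subset by (auto simp: nsets_def card_gt_0_iff)
  have "z ^ M * ?n ^ s + (?n choose s) * (z ^ M) ^ s
      \<le> z ^ M * (z ^ K) ^ s + (z ^ K) ^ s * (z ^ M) ^ s"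
    using card_verts order_trans[OF choose_le_power power_mono[OF card_verts, of s]]
    by (intro add_mono mult_le_mono power_mono) auto
  also have "\<dots> = z ^ (K * s) * (z ^ M + z ^ (M * s))"
    by (simp add: algebra_simps flip: power_mult)
  also have "\<dots> \<le> z ^ (K * s) * z ^ (M * s + M + 1)"
  proof (rule mult_le_mono2)
    have "z ^ M * 1 \<le> z ^ M * z ^ (M * s)" "1 * z ^ (M * s) \<le> z ^ M * z ^ (M * s)"
      using \<open>2 \<le> z\<close> by (intro mult_le_mono; simp)+
    then have "z ^ M + z ^ (M * s) \<le> 2 * (z ^ M * z ^ (M * s))" by linarith
    also have "\<dots> \<le> z * (z ^ M * z ^ (M * s))"
      using \<open>2 \<le> z\<close> by (rule mult_le_mono1)
    also have "\<dots> = z ^ (M * s + M + 1)" by (simp add: power_add)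
    finally show "z ^ M + z ^ (M * s) \<le> z ^ (M * s + M + 1)" .
  qed
  also have "\<dots> = z ^ (K * s + K - s)"
  proof -
    have "K * s + (M * s + M + 1) = K * s + K - s" by (simp add: K_def)
    then show ?thesis by (simp only: flip: power_add)
  qed
  also have "\<dots> \<le> (\<Sum>x\<in>verts G. card (neighbours x) ^ s)"
    using \<open>2 \<le> z\<close> \<open>0 < s\<close> card_verts card_edges by (intro sum_degree_powers_ge) (auto simp: K_def)
  finally show "z ^ M * ?n ^ s + (?n choose s) * (z ^ M) ^ s
      \<le> (\<Sum>x\<in>verts G. card (neighbours x) ^ s)" .
qed (fact \<open>0 < s\<close>)

end

section \<open>Graphs without large bicliques\<close>

definition biclique_edges :: "'a set \<Rightarrow> 'a set \<Rightarrow> 'a set set" where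
  "biclique_edges X Y = (\<lambda>(x, y). {x, y}) ` (X \<times> Y)"

definition has_biclique :: "nat \<Rightarrow> 'a ugraph \<Rightarrow> bool" where
  "has_biclique z G \<longleftrightarrow> (\<exists>X Y. X \<subseteq> verts G \<and> Y \<subseteq> verts G \<and> X \<inter> Y = {} \<and>
     card X = z \<and> card Y = z \<and> biclique_edges X Y \<subseteq> edges G)"

lemma has_biclique_subgraph:
  assumes "subgraph H G" "has_biclique z H"
  shows "has_biclique z G"
proof -
  obtain X Y where "X \<subseteq> verts H" "Y \<subseteq> verts H" "X \<inter> Y = {}" "card X = z" "card Y = z"
    "biclique_edges X Y \<subseteq> edges H"
    using assms(2) by (auto simp: has_biclique_def)
  then show ?thesis
    using assms(1) unfolding has_biclique_def subgraph_def
    by (intro exI[of _ X] exI[of _ Y]) auto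
qed

locale biclique_free = fin_graph G for G :: "'a ugraph" +
  fixes z :: nat
  assumes z_ge_2: "2 \<le> z"
    and biclique_free: "\<not> has_biclique z G"
begin

text \<open>The summand \<open>1\<close> accounts for \<open>x\<close> itself and makes \<open>crowded W\<close> empty when \<open>W\<close> is small.\<close>

definition crowded :: "'a set \<Rightarrow> 'a set" where
  "crowded W = {x \<in> verts G. z\<^sup>2 * (card (W \<inter> non_neighbours x) + 1) < card W}"

lemma crowded_subset: "crowded W \<subseteq> verts G"
  by (auto simp: crowded_def)

lemma finite_crowded: "finite (crowded W)"
  using finite_subset[OF crowded_subset finite_verts] .

lemma card_UN_closed_non_neighbours_le:
  assumes "finite W" "finite X" "X \<subseteq> crowded W"
  shows "z\<^sup>2 * card (\<Union>x\<in>X. insert x (W \<inter> non_neighbours x)) \<le> card X * card W"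
proof -
  have "card (\<Union>x\<in>X. insert x (W \<inter> non_neighbours x)) \<le> (\<Sum>x\<in>X. card (insert x (W \<inter> non_neighbours x)))"
    using assms(2) by (rule card_UN_le)
  also have "\<dots> \<le> (\<Sum>x\<in>X. card (W \<inter> non_neighbours x) + 1)"
    using assms(1) by (intro sum_mono) (simp add: card_insert_if)
  finally have "z\<^sup>2 * card (\<Union>x\<in>X. insert x (W \<inter> non_neighbours x))
      \<le> (\<Sum>x\<in>X. z\<^sup>2 * (card (W \<inter> non_neighbours x) + 1))"
    unfolding sum_distrib_left[symmetric] by (rule mult_le_mono2)
  also have "\<dots> \<le> (\<Sum>x\<in>X. card W)"
    using assms(3) by (intro sum_mono) (auto simp: crowded_def)
  finally show ?thesis by simp
qed

lemma card_crowded_less: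
  assumes "W \<subseteq> verts G"
  shows "card (crowded W) < z"
proof (rule ccontr)
  assume "\<not> ?thesis"
  then obtain X where X: "X \<subseteq> crowded W" "card X = z" "finite X"
    by (metis not_less obtain_subset_with_card_n)
  then obtain x where "x \<in> X" using z_ge_2 by fastforce
  then have "z\<^sup>2 * (card (W \<inter> non_neighbours x) + 1) < card W"
    using X(1) by (auto simp: crowded_def)
  moreover have "z * 2 \<le> z\<^sup>2"
    using z_ge_2 by (simp add: power2_eq_square)
  ultimately have W_large: "2 * z \<le> card W"
    by (simp add: algebra_simps)
  define Z where "Z = (\<Union>x\<in>X. insert x (W \<inter> non_neighbours x))"
  have finite_W: "finite W" using assms finite_verts by (rule finite_subset)
  have "z * card Z \<le> card W"
    using card_UN_closed_non_neighbours_le[OF finite_W X(3,1)] X(2) z_ge_2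
    by (simp add: Z_def power2_eq_square)
  then have "2 * card Z \<le> card W"
    using mult_le_mono1[OF z_ge_2, of "card Z"] by linarith
  moreover have "finite Z" using X(3) finite_W by (auto simp: Z_def)
  then have "card W - card Z \<le> card (W - Z)" by (rule diff_card_le_card_Diff)
  ultimately have "z \<le> card (W - Z)" using W_large by linarith
  then obtain Y where Y: "Y \<subseteq> W - Z" "card Y = z"
    by (metis obtain_subset_with_card_n)
  have "X \<inter> Y = {}" using Y(1) by (auto simp: Z_def)
  moreover have "{x, y} \<in> edges G" if "x \<in> X" "y \<in> Y" for x y
    using that Y(1) assms unfolding Z_def non_neighbours_def by blast
  then have "biclique_edges X Y \<subseteq> edges G" by (auto simp: biclique_edges_def)
  moreover have "X \<subseteq> verts G" "Y \<subseteq> verts G" using X(1) Y(1) assms crowded_subset by blast+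
  ultimately show False
    using biclique_free X(2) Y(2) unfolding has_biclique_def by simp
qed

lemma card_le_card_Int_non_neighbours:
  assumes "x \<in> verts G" "x \<notin> crowded W" "z ^ 3 \<le> card W"
  shows "card W \<le> z ^ 3 * card (W \<inter> non_neighbours x)"
proof -
  let ?c = "card (W \<inter> non_neighbours x)"
  have W_le: "card W \<le> z\<^sup>2 * (?c + 1)"
    using assms(1,2) by (auto simp: crowded_def)
  with assms(3) have "z\<^sup>2 * z \<le> z\<^sup>2 * (?c + 1)"
    by (simp add: power2_eq_square power3_eq_cube)
  then have "z \<le> ?c + 1" using z_ge_2 unfolding mult_le_cancel1 by simp
  then have "?c + 1 \<le> 2 * ?c" using z_ge_2 by linarith
  also have "\<dots> \<le> z * ?c" using z_ge_2 by simp
  finally have "z\<^sup>2 * (?c + 1) \<le> z\<^sup>2 * (z * ?c)" by (rule mult_le_mono2)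
  with W_le show ?thesis by (simp add: power2_eq_square power3_eq_cube)
qed

lemma power_le_card_Int_non_neighbours:
  assumes "x \<in> verts G" "x \<notin> crowded W" "z ^ (3 + e) \<le> card W"
  shows "z ^ e \<le> card (W \<inter> non_neighbours x)"
proof -
  have "z ^ 3 \<le> z ^ (3 + e)" using z_ge_2 by (intro power_increasing) auto
  then have "z ^ 3 * z ^ e \<le> z ^ 3 * card (W \<inter> non_neighbours x)"
    using assms card_le_card_Int_non_neighbours order_trans by (metis power_add)
  then show ?thesis using z_ge_2 by simp
qed

section \<open>Independent transversals\<close>

definition independent_transversals :: "'b set \<Rightarrow> ('b \<Rightarrow> 'a set) \<Rightarrow> ('b \<Rightarrow> 'a) set" where
  "independent_transversals I Y = {g \<in> Pi\<^sub>E I Y. independent_family g I}"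

lemma independent_transversals_insert:
  assumes "i \<notin> I" "\<And>l. l \<in> insert i I \<Longrightarrow> Y l \<subseteq> verts G"
  shows "independent_transversals (insert i I) Y = (\<lambda>(x, g). g(i := x)) `
    (SIGMA x:Y i. independent_transversals I (\<lambda>l. Y l \<inter> non_neighbours x))"
    (is "?L = ?ext ` ?S")
proof (intro equalityI subsetI)
  fix f assume f: "f \<in> ?L"
  then have "f = ?ext (f i, f(i := undefined))" by simp
  moreover have "(f i, f(i := undefined)) \<in> ?S"
    using f assms(1)
    by (auto simp: independent_transversals_def pairwise_def PiE_iff extensional_def)
  ultimately show "f \<in> ?ext ` ?S" by blast
next
  fix f assume "f \<in> ?ext ` ?S"
  then obtain x g where f: "f = g(i := x)" and x: "x \<in> Y i"
    and g: "g \<in> Pi\<^sub>E I (\<lambda>l. Y l \<inter> non_neighbours x)" "independent_family g I"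
    by (auto simp: independent_transversals_def)
  have "x \<in> non_neighbours (g l)" if "l \<in> I" for l
  proof -
    have "g l \<in> Y l" "g l \<in> non_neighbours x" using g(1) that by auto
    then show ?thesis using non_neighbours_sym x that assms(2) by (meson insertCI subsetD)
  qed
  then have "independent_family f (insert i I)"
    using f g assms(1) by (auto simp: pairwise_def PiE_iff)
  then show "f \<in> ?L"
    using f x g(1) assms(1)
    by (auto simp: independent_transversals_def PiE_iff extensional_def)
qed

lemma card_independent_transversals_insert:
  assumes "finite I" "i \<notin> I" and Y: "\<And>l. l \<in> insert i I \<Longrightarrow> Y l \<subseteq> verts G"
  shows "card (independent_transversals (insert i I) Y)
    = (\<Sum>x\<in>Y i. card (independent_transversals I (\<lambda>l. Y l \<inter> non_neighbours x)))"
proof -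
  let ?S = "SIGMA x:Y i. independent_transversals I (\<lambda>l. Y l \<inter> non_neighbours x)"
  have finite_Y: "finite (Y l)" if "l \<in> insert i I" for l
    using finite_subset[OF Y[OF that] finite_verts] .
  have "finite (independent_transversals I (\<lambda>l. Y l \<inter> non_neighbours x))" for x
    using assms(1) finite_Y unfolding independent_transversals_def
    by (intro finite_subset[OF Collect_restrict] finite_PiE) auto
  moreover have "inj_on (\<lambda>(x, g). g(i := x)) ?S"
    by (rule inj_on_subset[OF inj_combinator[OF assms(2), of Y]])
       (auto simp: independent_transversals_def)
  moreover have "independent_transversals (insert i I) Y = (\<lambda>(x, g). g(i := x)) ` ?S"
    using assms(2) Y by (rule independent_transversals_insert)
  ultimately show ?thesis
    using finite_Y by (simp add: card_image)
qed

lemma prod_card_le_prod_card_Int_non_neighbours: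
  assumes "x \<in> verts G" and "\<And>i. i \<in> I \<Longrightarrow> x \<notin> crowded (Y i) \<and> z ^ 3 \<le> card (Y i)"
  shows "(\<Prod>i\<in>I. card (Y i)) \<le> z ^ (3 * card I) * (\<Prod>i\<in>I. card (Y i \<inter> non_neighbours x))"
proof -
  have "(\<Prod>i\<in>I. card (Y i)) \<le> (\<Prod>i\<in>I. z ^ 3 * card (Y i \<inter> non_neighbours x))"
    using assms by (intro prod_mono conjI card_le_card_Int_non_neighbours) auto
  then show ?thesis by (simp add: prod.distrib power_mult)
qed

lemma card_le_card_Diff_crowded:
  assumes "finite I" "card I \<le> z" "\<And>i. i \<in> I \<Longrightarrow> Y i \<subseteq> verts G" and W: "z ^ 3 \<le> card W"
  shows "card W \<le> z * card (W - (\<Union>i\<in>I. crowded (Y i)))"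
proof -
  let ?C = "\<Union>i\<in>I. crowded (Y i)"
  have "card ?C \<le> (\<Sum>i\<in>I. card (crowded (Y i)))"
    using assms(1) by (rule card_UN_le)
  also have "\<dots> \<le> (\<Sum>i\<in>I. z)"
    using card_crowded_less assms(3) by (intro sum_mono less_imp_le) auto
  also have "\<dots> \<le> z * z" using assms(2) by simp
  finally have "card W \<le> card (W - ?C) + z * z"
    using diff_card_le_card_Diff[of ?C W] assms(1) finite_crowded by simp
  moreover have "2 * (z * z) \<le> card W"
    using order_trans[OF mult_le_mono1[OF z_ge_2]] W by (simp add: power3_eq_cube mult.assoc)
  moreover have "2 * card (W - ?C) \<le> z * card (W - ?C)"
    using z_ge_2 by (rule mult_le_mono1)
  ultimately show ?thesis by linarith
qed

lemma prod_card_insert_le_sum: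
  assumes I: "finite I" "i \<notin> I" "card I \<le> z"
    and Y: "\<And>l. l \<in> insert i I \<Longrightarrow> Y l \<subseteq> verts G" "z ^ 3 \<le> card (Y i)"
    and uncrowded: "\<And>x. x \<in> Y i \<Longrightarrow> (\<And>l. l \<in> I \<Longrightarrow> x \<notin> crowded (Y l)) \<Longrightarrow> (\<Prod>l\<in>I. card (Y l)) \<le> c * N x"
  shows "(\<Prod>l\<in>insert i I. card (Y l)) \<le> z * c * (\<Sum>x\<in>Y i. N x)"
proof -
  define C where "C = Y i - (\<Union>l\<in>I. crowded (Y l))"
  have "card (Y i) \<le> z * card C"
    unfolding C_def using I(1,3) Y by (intro card_le_card_Diff_crowded) auto
  then have "(\<Prod>l\<in>insert i I. card (Y l)) \<le> z * (\<Sum>x\<in>C. \<Prod>l\<in>I. card (Y l))"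
    using I(1,2) by (simp add: mult.assoc[symmetric])
  also have "\<dots> \<le> z * (\<Sum>x\<in>C. c * N x)"
    using uncrowded by (intro mult_le_mono2 sum_mono) (auto simp: C_def)
  also have "\<dots> = z * c * (\<Sum>x\<in>C. N x)"
    by (simp add: sum_distrib_left mult.assoc)
  also have "\<dots> \<le> z * c * (\<Sum>x\<in>Y i. N x)"
    using finite_subset[OF Y(1) finite_verts] by (intro mult_le_mono2 sum_mono2) (auto simp: C_def)
  finally show ?thesis .
qed

lemma prod_card_le_card_independent_transversals:
  assumes "finite I" "card I \<le> z"
    and "\<And>i. i \<in> I \<Longrightarrow> Y i \<subseteq> verts G \<and> z ^ (3 * card I) \<le> card (Y i)"
  shows "(\<Prod>i\<in>I. card (Y i)) \<le> z ^ (3 * (card I)\<^sup>2) * card (independent_transversals I Y)"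
  using assms
proof (induction I arbitrary: Y rule: finite_induct)
  case empty
  then show ?case by (simp add: independent_transversals_def)
next
  case (insert i I)
  let ?m = "card I"
  let ?count = "\<lambda>x. card (independent_transversals I (\<lambda>l. Y l \<inter> non_neighbours x))"
  have card_insert: "card (insert i I) = ?m + 1" and m_le: "?m \<le> z"
    using insert.hyps insert.prems(1) by simp_all
  have Y: "Y l \<subseteq> verts G" "z ^ (3 + 3 * ?m) \<le> card (Y l)" if "l \<in> insert i I" for l
    using insert.prems(2)[OF that] by (simp_all add: card_insert)
  have Y_ge: "z ^ 3 \<le> card (Y l)" if "l \<in> insert i I" for l
    using z_ge_2 by (intro order_trans[OF power_increasing Y(2)[OF that]]) auto
  have "(\<Prod>l\<in>I. card (Y l)) \<le> z ^ (3 * ?m + 3 * ?m\<^sup>2) * ?count x"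
    if x: "x \<in> Y i" "\<And>l. l \<in> I \<Longrightarrow> x \<notin> crowded (Y l)" for x
  proof -
    have "x \<in> verts G" using x(1) Y(1)[of i] by auto
    then have large: "z ^ (3 * ?m) \<le> card (Y l \<inter> non_neighbours x)" if "l \<in> I" for l
      using that x(2) Y(2) by (intro power_le_card_Int_non_neighbours) auto
    have "(\<Prod>l\<in>I. card (Y l)) \<le> z ^ (3 * ?m) * (\<Prod>l\<in>I. card (Y l \<inter> non_neighbours x))"
      using \<open>x \<in> verts G\<close> x(2) Y_ge by (intro prod_card_le_prod_card_Int_non_neighbours) auto
    also have "\<dots> \<le> z ^ (3 * ?m) * (z ^ (3 * ?m\<^sup>2) * ?count x)"
      using large m_le Y(1) by (intro mult_le_mono2 insert.IH) auto
    finally show ?thesis by (simp add: power_add)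
  qed
  then have "(\<Prod>l\<in>insert i I. card (Y l)) \<le> z * z ^ (3 * ?m + 3 * ?m\<^sup>2) * (\<Sum>x\<in>Y i. ?count x)"
    using insert.hyps m_le Y(1) Y_ge by (intro prod_card_insert_le_sum) auto
  also have "\<dots> \<le> z ^ (3 * (?m + 1)\<^sup>2) * (\<Sum>x\<in>Y i. ?count x)"
    unfolding power_Suc[symmetric]
    using z_ge_2 by (intro mult_le_mono1 power_increasing) (auto simp: power2_eq_square)
  also have "(\<Sum>x\<in>Y i. ?count x) = card (independent_transversals (insert i I) Y)"
    using insert.hyps Y(1) by (rule card_independent_transversals_insert[symmetric])
  finally show ?case by (simp add: card_insert)
qed

corollary independent_transversals_nonempty:
  assumes "finite I" "card I \<le> z"
    and Y: "\<And>i. i \<in> I \<Longrightarrow> Y i \<subseteq> verts G \<and> z ^ (3 * card I) \<le> card (Y i)"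
  shows "independent_transversals I Y \<noteq> {}"
proof -
  have "0 < card (Y i)" if "i \<in> I" for i
    using z_ge_2 Y[OF that] by (cases "card (Y i)") auto
  then have "0 < (\<Prod>i\<in>I. card (Y i))" by (rule prod_pos)
  also have "\<dots> \<le> z ^ (3 * (card I)\<^sup>2) * card (independent_transversals I Y)"
    using assms by (rule prod_card_le_card_independent_transversals)
  finally show ?thesis by auto
qed

section \<open>Generic sets\<close>

definition generic :: "'a set \<Rightarrow> bool" where
  "generic R \<longleftrightarrow> (\<forall>S T. S \<subseteq> R \<longrightarrow> T \<subseteq> R \<longrightarrow> (\<forall>x\<in>R - (S \<union> T). x \<notin> crowded (witnesses S T)))"

lemma card_common_neighbours_le_card_witnesses:
  assumes "generic R" "R \<subseteq> verts G" "S \<subseteq> R" "S \<inter> T = {}" "T \<subseteq> R"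
    and "z ^ (3 * card T) \<le> card (common_neighbours S)"
  shows "card (common_neighbours S) \<le> z ^ (3 * card T) * card (witnesses S T)"
proof -
  have "finite T" using assms(2,5) finite_verts by (meson finite_subset)
  then show ?thesis
    using assms(4-6)
  proof (induction T rule: finite_induct)
    case empty
    then show ?case by simp
  next
    case (insert x T)
    have large: "z ^ (3 * card T) * z ^ 3 \<le> card (common_neighbours S)"
      using insert.prems(3) insert.hyps by (simp add: mult.commute flip: power_add)
    then have "z ^ (3 * card T) \<le> card (common_neighbours S)"
      using z_ge_2 by (intro order_trans[OF _ large]) simp
    then have IH: "card (common_neighbours S) \<le> z ^ (3 * card T) * card (witnesses S T)"
      using insert.IH insert.prems by auto
    with large have "z ^ (3 * card T) * z ^ 3 \<le> z ^ (3 * card T) * card (witnesses S T)"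
      by (rule order_trans)
    then have "z ^ 3 \<le> card (witnesses S T)" using z_ge_2 by simp
    moreover have x: "x \<in> verts G" "x \<notin> crowded (witnesses S T)"
      using assms(1-3) insert.hyps insert.prems by (auto simp: generic_def)
    ultimately have "card (witnesses S T) \<le> z ^ 3 * card (witnesses S (insert x T))"
      unfolding witnesses_insert_right[OF x(1)] by (intro card_le_card_Int_non_neighbours)
    then have "card (common_neighbours S) \<le> z ^ (3 * card T) * (z ^ 3 * card (witnesses S (insert x T)))"
      by (intro order_trans[OF IH] mult_le_mono2)
    then show ?case using insert.hyps by (simp add: power_add algebra_simps)
  qed
qed

lemma card_maps_hitting_crowded_le:
  assumes "finite I" "j \<in> I" "U \<subseteq> verts G"
  shows "card {f \<in> I \<rightarrow>\<^sub>E U. j \<notin> S \<union> T \<and> f j \<in> crowded (witnesses (f ` S) (f ` T))}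
    \<le> z * card U ^ (card I - 1)"
proof (cases "j \<in> S \<union> T")
  case False
  have "finite U" using assms(3) finite_verts by (rule finite_subset)
  then have "card {f \<in> I \<rightarrow>\<^sub>E U. f j \<in> crowded (witnesses (f ` S) (f ` T))} \<le> z * card U ^ (card I - 1)"
    using assms(1,2)
  proof (rule card_PiE_hit_le)
    fix f :: "'b \<Rightarrow> 'a"
    show "crowded (witnesses (f(j := x) ` S) (f(j := x) ` T)) = crowded (witnesses (f ` S) (f ` T))" for x
    proof -
      have "f(j := x) ` S = f ` S" "f(j := x) ` T = f ` T" using False by auto
      then show ?thesis by simp
    qed
    show "card (crowded (witnesses (f ` S) (f ` T)) \<inter> U) \<le> z"
      using card_mono[OF finite_crowded Int_lower1] card_crowded_less[OF witnesses_subset]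
      by (meson less_imp_le order_trans)
  qed
  with False show ?thesis by simp
qed auto

lemma not_generic_imageE:
  assumes "\<not> generic (f ` I)"
  obtains S T j where "S \<subseteq> I" "T \<subseteq> I" "j \<in> I - (S \<union> T)" "f j \<in> crowded (witnesses (f ` S) (f ` T))"
proof -
  obtain S T x where ST: "S \<subseteq> f ` I" "T \<subseteq> f ` I" and x: "x \<in> f ` I - (S \<union> T)" "x \<in> crowded (witnesses S T)"
    using assms by (auto simp: generic_def)
  obtain j where j: "j \<in> I" "x = f j" using x(1) by blast
  have "S = f ` (I \<inter> f -` S)" "T = f ` (I \<inter> f -` T)" using ST by auto
  with x(2) j(2) have "f j \<in> crowded (witnesses (f ` (I \<inter> f -` S)) (f ` (I \<inter> f -` T)))" by simp
  then show thesis
    using that[of "I \<inter> f -` S" "I \<inter> f -` T" j] x(1) j by auto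
qed

text \<open>A greedy choice of a generic set fails because \<open>x\<close> may have to be chosen before the elements of
  \<open>S\<close> and \<open>T\<close>; hence the union bound over all maps.\<close>

lemma card_non_generic_maps_le:
  assumes "finite I" "card I \<le> z" "U \<subseteq> verts G"
  shows "card {f \<in> I \<rightarrow>\<^sub>E U. \<not> generic (f ` I)} \<le> z ^ (2 * card I + 2) * card U ^ (card I - 1)"
proof -
  let ?triples = "Pow I \<times> Pow I \<times> I"
  define Hit where "Hit = (\<lambda>(S, T, j).
    {f \<in> I \<rightarrow>\<^sub>E U. j \<notin> S \<union> T \<and> f j \<in> crowded (witnesses (f ` S) (f ` T))})"
  have finite_Hit: "finite (Hit \<tau>)" for \<tau>
    using assms(1) finite_subset[OF assms(3) finite_verts]
    by (auto simp: Hit_def case_prod_unfold intro!: finite_subset[OF Collect_restrict] finite_PiE)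
  have "{f \<in> I \<rightarrow>\<^sub>E U. \<not> generic (f ` I)} \<subseteq> (\<Union>\<tau>\<in>?triples. Hit \<tau>)"
  proof
    fix f assume f: "f \<in> {f \<in> I \<rightarrow>\<^sub>E U. \<not> generic (f ` I)}"
    then obtain S T j where "S \<subseteq> I" "T \<subseteq> I" "j \<in> I - (S \<union> T)" "f j \<in> crowded (witnesses (f ` S) (f ` T))"
      using not_generic_imageE[of f I] by auto
    then show "f \<in> (\<Union>\<tau>\<in>?triples. Hit \<tau>)"
      using f by (intro UN_I[of "(S, T, j)"]) (simp_all add: Hit_def)
  qed
  then have "card {f \<in> I \<rightarrow>\<^sub>E U. \<not> generic (f ` I)} \<le> card (\<Union>\<tau>\<in>?triples. Hit \<tau>)"
    using assms(1) finite_Hit by (intro card_mono) auto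
  also have "\<dots> \<le> (\<Sum>\<tau>\<in>?triples. card (Hit \<tau>))"
    using assms(1) by (intro card_UN_le) simp
  also have "\<dots> \<le> (\<Sum>\<tau>\<in>?triples. z * card U ^ (card I - 1))"
    using card_maps_hitting_crowded_le[OF assms(1) _ assms(3)]
    by (intro sum_mono) (auto simp: Hit_def)
  also have "\<dots> = (2 ^ card I * (2 ^ card I * card I)) * (z * card U ^ (card I - 1))"
    using assms(1) by (simp add: card_cartesian_product card_Pow)
  also have "\<dots> \<le> (z ^ card I * (z ^ card I * z)) * (z * card U ^ (card I - 1))"
    using z_ge_2 assms(2) by (intro mult_le_mono power_mono) auto
  also have "\<dots> = z ^ (2 * card I + 2) * card U ^ (card I - 1)"
    by (simp add: mult_2 power_add)
  finally show ?thesis .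
qed

lemma card_non_generic_maps_less_card_independent_transversals:
  assumes "0 < a" "a \<le> z" "U \<subseteq> verts G" and U: "z ^ (3 * (a + 1)\<^sup>2) \<le> card U"
  shows "card {f \<in> {..<a} \<rightarrow>\<^sub>E U. \<not> generic (f ` {..<a})}
    < card (independent_transversals {..<a} (\<lambda>_. U))" (is "?bad < ?ind")
proof -
  let ?u = "card U"
  have "z ^ (3 * a\<^sup>2) * ?bad \<le> z ^ (3 * a\<^sup>2) * (z ^ (2 * a + 2) * ?u ^ (a - 1))"
    using card_non_generic_maps_le[of "{..<a}" U] assms(2,3) by (intro mult_le_mono2) simp
  also have "\<dots> = z ^ (3 * a\<^sup>2 + 2 * a + 2) * ?u ^ (a - 1)"
    by (simp add: power_add)
  also have "\<dots> < z ^ (3 * (a + 1)\<^sup>2) * ?u ^ (a - 1)"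
  proof (rule mult_strict_right_mono)
    show "z ^ (3 * a\<^sup>2 + 2 * a + 2) < z ^ (3 * (a + 1)\<^sup>2)"
      using z_ge_2 by (intro power_strict_increasing) (auto simp: power2_eq_square)
    show "0 < ?u ^ (a - 1)"
      using U z_ge_2 by (cases ?u) auto
  qed
  also have "\<dots> \<le> ?u * ?u ^ (a - 1)" using U by (rule mult_le_mono1)
  also have "\<dots> = ?u ^ a" using \<open>0 < a\<close> by (simp add: power_eq_if)
  also have "\<dots> \<le> z ^ (3 * a\<^sup>2) * ?ind"
  proof -
    have "z ^ (3 * a) \<le> z ^ (3 * (a + 1)\<^sup>2)"
      using z_ge_2 by (intro power_increasing) (auto simp: power2_eq_square)
    then show ?thesis
      using prod_card_le_card_independent_transversals[of "{..<a}" "\<lambda>_. U"] assms(2,3) U by simp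
  qed
  finally show ?thesis by simp
qed

lemma exists_generic_independent_set:
  assumes "0 < a" "a \<le> z" "U \<subseteq> verts G" "z ^ (3 * (a + 1)\<^sup>2) \<le> card U"
  shows "\<exists>R\<subseteq>U. card R = a \<and> independent R \<and> generic R"
proof -
  let ?I = "{..<a}"
  let ?bad = "{f \<in> ?I \<rightarrow>\<^sub>E U. \<not> generic (f ` ?I)}"
  have "finite U" using assms(3) finite_verts by (rule finite_subset)
  then have "finite ?bad" by (simp add: finite_PiE)
  then have "\<not> independent_transversals ?I (\<lambda>_. U) \<subseteq> ?bad"
    using card_mono card_non_generic_maps_less_card_independent_transversals[OF assms] not_less by blast
  then obtain f where f: "f \<in> ?I \<rightarrow>\<^sub>E U" "generic (f ` ?I)"
    and indep: "independent_family f ?I"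
    by (auto simp: independent_transversals_def)
  have "inj_on f ?I"
  proof (rule inj_onI, rule ccontr)
    fix i j assume "i \<in> ?I" "j \<in> ?I" "f i = f j" "i \<noteq> j"
    then have "f j \<in> non_neighbours (f i)" using indep by (auto dest: pairwiseD)
    with \<open>f i = f j\<close> show False by (simp add: non_neighbours_def)
  qed
  then have "card (f ` ?I) = a" by (simp add: card_image)
  moreover have "f ` ?I \<subseteq> U" using f(1) by auto
  moreover have "independent (f ` ?I)"
    unfolding pairwise_image using indep by (rule pairwise_mono) auto
  ultimately show ?thesis using f(2) by blast
qed

lemma generic_imp_power_le_card_witnesses:
  assumes "generic R" "R \<subseteq> verts G" "S \<subseteq> R" and common: "z ^ (3 * card R + e) \<le> card (common_neighbours R)"
  shows "z ^ e \<le> card (witnesses S (R - S))"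
proof -
  let ?T = "R - S"
  have "card ?T \<le> card R"
    using assms(2) finite_verts finite_subset by (intro card_mono) auto
  then have "z ^ (3 * card ?T + e) \<le> z ^ (3 * card R + e)"
    using z_ge_2 by (intro power_increasing) auto
  also have "\<dots> \<le> card (common_neighbours S)"
    using assms(3)
    by (intro order_trans[OF common] card_mono[OF finite_witnesses]) (auto simp: witnesses_def)
  finally have large: "z ^ (3 * card ?T) * z ^ e \<le> card (common_neighbours S)"
    by (simp add: power_add)
  then have "z ^ (3 * card ?T) \<le> card (common_neighbours S)"
    using z_ge_2 by (intro order_trans[OF _ large]) simp
  then have "card (common_neighbours S) \<le> z ^ (3 * card ?T) * card (witnesses S ?T)"
    using assms(1-3) by (intro card_common_neighbours_le_card_witnesses) auto
  with large have "z ^ (3 * card ?T) * z ^ e \<le> z ^ (3 * card ?T) * card (witnesses S ?T)"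
    by (rule order_trans)
  then show ?thesis using z_ge_2 by simp
qed

text \<open>The summands of \<open>M\<close> pay for the choice of a generic set and for the \<open>z\<^bsup>3b\<^esup>\<close> witnesses left after
  losing a factor \<open>z\<^sup>3\<close> for each non-adjacency.\<close>

lemma exists_rich_independent_set:
  fixes a b :: nat
  defines "M \<equiv> 3 * (a + 1)\<^sup>2 + 3 * b"
  defines "K \<equiv> (M + 1) * (a + 1)"
  assumes a: "0 < a" "a \<le> z"
    and dense: "card (verts G) \<le> z ^ K" "z ^ (2 * K - 1) \<le> card (edges G)"
  shows "\<exists>R\<subseteq>verts G. card R = a \<and> independent R \<and>
    (\<forall>S\<subseteq>R. z ^ (3 * b) \<le> card (witnesses S (R - S)))"
proof -
  obtain U where U: "U \<subseteq> verts G" "z ^ M \<le> card U"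
    and common: "\<And>S. S \<subseteq> U \<Longrightarrow> card S = a \<Longrightarrow> z ^ M \<le> card (common_neighbours S)"
    using dependent_random_choice_dense[OF z_ge_2 a(1) dense[unfolded K_def]] by blast
  have "z ^ (3 * (a + 1)\<^sup>2) \<le> z ^ M"
    using z_ge_2 by (intro power_increasing) (auto simp: M_def)
  then obtain R where R: "R \<subseteq> U" "card R = a" "independent R" "generic R"
    using exists_generic_independent_set[OF a U(1)] U(2) order_trans by blast
  have "z ^ (3 * card R + 3 * b) \<le> z ^ M"
    using z_ge_2 R(2) by (intro power_increasing) (auto simp: M_def power2_eq_square)
  also have "\<dots> \<le> card (common_neighbours R)" using R(1,2) by (rule common)
  finally have "z ^ (3 * b) \<le> card (witnesses S (R - S))" if "S \<subseteq> R" for S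
    using R(1,4) U(1) that by (intro generic_imp_power_le_card_witnesses) auto
  with R U(1) show ?thesis by blast
qed

end

section \<open>Induced bipartite subgraphs\<close>

definition bipartition :: "'a ugraph \<Rightarrow> 'a set \<Rightarrow> 'a set \<Rightarrow> bool" where
  "bipartition L A B \<longleftrightarrow> A \<union> B = verts L \<and> A \<inter> B = {} \<and> (\<forall>e\<in>edges L. \<exists>a\<in>A. \<exists>b\<in>B. e = {a, b})"

lemma bipartitionD:
  assumes "bipartition L A B"
  shows "verts L = A \<union> B" "A \<inter> B = {}" "e \<in> edges L \<Longrightarrow> \<exists>a\<in>A. \<exists>b\<in>B. e = {a, b}"
  using assms by (auto simp: bipartition_def)

definition induced_embedding :: "('b \<Rightarrow> 'a) \<Rightarrow> 'b ugraph \<Rightarrow> 'a ugraph \<Rightarrow> bool" where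
  "induced_embedding h L G \<longleftrightarrow> inj_on h (verts L) \<and> h ` verts L \<subseteq> verts G \<and>
     (\<forall>u\<in>verts L. \<forall>v\<in>verts L. {h u, h v} \<in> edges G \<longleftrightarrow> {u, v} \<in> edges L)"

lemma hereditary_property_induced_embedding:
  assumes P: "hereditary_property P" and "G \<in> P" "finite_graph L" and h: "induced_embedding h L G"
  shows "L \<in> P"
proof -
  let ?W = "h ` verts L" and ?inv = "inv_into (verts L) h"
  have inj: "inj_on h (verts L)" using h by (simp add: induced_embedding_def)
  then have "bij_betw ?inv ?W (verts L)"
    by (intro bij_betw_inv_into inj_on_imp_bij_betw)
  then have "isomorphic (induced G ?W) L"
    using h inj unfolding isomorphic_def induced_def induced_embedding_def
    by (auto intro!: exI[of _ ?inv])
  moreover have "induced G ?W \<in> P"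
    using P \<open>G \<in> P\<close> h unfolding hereditary_property_def induced_embedding_def by blast
  ultimately show ?thesis
    using P \<open>finite_graph L\<close> unfolding hereditary_property_def by blast
qed

lemma ex_num_attained:
  assumes "finite_graph G" "hereditary_property P"
  shows "\<exists>H. subgraph H G \<and> H \<in> P \<and> card (edges H) = ex_num G P"
  using Max_in[OF ex_num_set_finite_nonempty[OF assms]] unfolding ex_num_def mem_Collect_eq by metis

lemma (in fin_graph) induced_embedding_bipartiteI:
  assumes L: "finite_graph L" "bipartition L A B"
    and verts: "h ` verts L \<subseteq> verts G"
    and indep: "independent_family h A" "independent_family h B"
    and cross: "\<And>a b. a \<in> A \<Longrightarrow> b \<in> B \<Longrightarrow>
      h a \<in> (if {a, b} \<in> edges L then neighbours (h b) else non_neighbours (h b))"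
  shows "induced_embedding h L G"
proof -
  have cross_adjacency: "h a \<noteq> h b \<and> ({h a, h b} \<in> edges G \<longleftrightarrow> {a, b} \<in> edges L)" if "a \<in> A" "b \<in> B" for a b
    using cross[OF that] no_loop
    by (auto simp: neighbours_def non_neighbours_def insert_commute split: if_splits)
  have same_side_independent: "h u \<noteq> h v \<and> {h u, h v} \<notin> edges G \<and> {u, v} \<notin> edges L"
    if "u \<noteq> v" "u \<in> A \<and> v \<in> A \<or> u \<in> B \<and> v \<in> B" for u v
  proof -
    have "h v \<in> non_neighbours (h u)" using that indep by (auto dest: pairwiseD)
    moreover have "{u, v} \<notin> edges L"
      using bipartitionD(2,3)[OF L(2)] that(2) by (fastforce simp: doubleton_eq_iff)
    ultimately show ?thesis by (auto simp: non_neighbours_def)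
  qed
  have "(u \<noteq> v \<longrightarrow> h u \<noteq> h v) \<and> ({h u, h v} \<in> edges G \<longleftrightarrow> {u, v} \<in> edges L)"
    if uv: "u \<in> verts L" "v \<in> verts L" for u v
  proof -
    consider (equal) "u = v" | (cross) "u \<in> A" "v \<in> B" | (cross_flipped) "u \<in> B" "v \<in> A"
      | (same_side) "u \<noteq> v" "u \<in> A \<and> v \<in> A \<or> u \<in> B \<and> v \<in> B"
      using uv unfolding bipartitionD(1)[OF L(2)] by blast
    then show ?thesis
    proof cases
      case equal
      then have "{u, v} \<notin> edges L" using L(1) by (auto simp: finite_graph_def nsets_def)
      with equal show ?thesis using no_loop by simp
    next
      case cross
      then show ?thesis using cross_adjacency by blast
    next
      case cross_flipped
      then show ?thesis using cross_adjacency[of v u] by (metis insert_commute)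
    next
      case same_side
      then show ?thesis using same_side_independent by blast
    qed
  qed
  with verts show ?thesis unfolding induced_embedding_def inj_on_def by blast
qed

lemma (in biclique_free) induced_embedding_of_rich_independent_set:
  fixes L :: "'b ugraph"
  assumes L: "finite_graph L" "bipartition L A B"
    and "card B \<le> z" and R: "R \<subseteq> verts G" "card R = card A"
    and R_indep: "independent R"
    and R_rich: "\<And>S. S \<subseteq> R \<Longrightarrow> z ^ (3 * card B) \<le> card (witnesses S (R - S))"
  shows "\<exists>h. induced_embedding h L G"
proof -
  have fin: "finite A" "finite B" "finite R"
    using L(1) finite_subset[OF R(1) finite_verts] unfolding finite_graph_def bipartitionD(1)[OF L(2)] by auto
  then obtain f where f: "inj_on f A" "f ` A = R"
    using R(2) finite_same_card_bij unfolding bij_betw_def by metis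
  define S where "S b = f ` {a \<in> A. {a, b} \<in> edges L}" for b
  define Y where "Y b = witnesses (S b) (R - S b)" for b
  have "S b \<subseteq> R" for b using f(2) by (auto simp: S_def)
  then have "independent_transversals B Y \<noteq> {}"
    using fin(2) \<open>card B \<le> z\<close> R_rich witnesses_subset
    by (intro independent_transversals_nonempty) (simp_all add: Y_def)
  then obtain g where g: "\<And>b. b \<in> B \<Longrightarrow> g b \<in> Y b"
    and g_indep: "independent_family g B"
    by (auto simp: independent_transversals_def)
  define h where "h x = (if x \<in> A then f x else g x)" for x
  have h_on_A: "h a = f a" if "a \<in> A" for a using that by (simp add: h_def)
  have h_on_B: "h b = g b" if "b \<in> B" for b using that bipartitionD(2)[OF L(2)] by (auto simp: h_def)
  have "induced_embedding h L G"
  proof (rule induced_embedding_bipartiteI[OF L])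
    have "g b \<in> verts G" if "b \<in> B" for b
      using g[OF that] witnesses_subset unfolding Y_def by blast
    then show "h ` verts L \<subseteq> verts G"
      using R(1) f(2) unfolding bipartitionD(1)[OF L(2)] by (auto simp: h_on_A h_on_B)
    show "independent_family h A"
      using R_indep f by (auto simp: h_on_A pairwise_def inj_on_def)
    show "independent_family h B"
      using g_indep by (simp add: h_on_B pairwise_def)
    fix a b assume ab: "a \<in> A" "b \<in> B"
    have "f a \<in> (if {a, b} \<in> edges L then S b else R - S b)"
      using ab f by (auto simp: S_def inj_on_def)
    then show "h a \<in> (if {a, b} \<in> edges L then neighbours (h b) else non_neighbours (h b))"
      using g[OF ab(2)] ab by (auto simp: h_on_A h_on_B Y_def witnesses_def split: if_splits)
  qed
  then show ?thesis by blast
qed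

lemma ex_num_less_if_no_biclique:
  fixes L :: "'a ugraph"
  assumes L: "finite_graph L" "bipartite L"
  shows "\<exists>K>0. \<exists>z\<^sub>0. \<forall>z\<ge>z\<^sub>0. \<forall>P G. hereditary_property P \<longrightarrow> L \<notin> P \<longrightarrow> finite_graph G \<longrightarrow>
    card (verts G) \<le> z ^ K \<longrightarrow> \<not> has_biclique z G \<longrightarrow> ex_num G P < z ^ (2 * K - 1)"
proof -
  obtain A B where AB: "bipartition L A B"
    using L(2) unfolding bipartite_def bipartition_def by blast
  have finite_A: "finite A" using L(1) unfolding finite_graph_def bipartitionD(1)[OF AB] by simp
  define K where "K = (3 * (card A + 1)\<^sup>2 + 3 * card B + 1) * (card A + 1)"
  have "ex_num G P < z ^ (2 * K - 1)"
    if z: "2 + card A + card B \<le> z" and P: "hereditary_property P" "L \<notin> P"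
      and G: "finite_graph G" "card (verts G) \<le> z ^ K" "\<not> has_biclique z G" for z P and G :: "'a ugraph"
  proof (rule ccontr)
    assume "\<not> ?thesis"
    moreover obtain H where H: "subgraph H G" "H \<in> P" "card (edges H) = ex_num G P"
      using ex_num_attained[OF G(1) P(1)] by blast
    ultimately have dense: "z ^ (2 * K - 1) \<le> card (edges H)" by simp
    have "card (verts H) \<le> card (verts G)"
      using H(1) G(1) by (auto simp: subgraph_def finite_graph_def intro: card_mono)
    then have few_verts: "card (verts H) \<le> z ^ K" using G(2) by (rule order_trans)
    interpret biclique_free H z
      using H(1) z G(3) has_biclique_subgraph[OF H(1)] by unfold_locales (auto simp: subgraph_def)
    have "A \<noteq> {}"
    proof
      assume "A = {}"
      then have "L = (verts L, {})" using bipartitionD(3)[OF AB] by (auto simp: prod_eq_iff)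
      then show False using P L(1) by (metis finite_graph_def hereditary_property_def)
    qed
    then have "0 < card A" "card A \<le> z" "card B \<le> z" using finite_A z by auto
    then obtain h where "induced_embedding h L H"
      using exists_rich_independent_set few_verts dense unfolding K_def
      using induced_embedding_of_rich_independent_set[OF L(1) AB \<open>card B \<le> z\<close>] by meson
    then show False
      using hereditary_property_induced_embedding P H(2) L(1) by blast
  qed
  moreover have "0 < K" by (simp add: K_def)
  ultimately show ?thesis by blast
qed

section \<open>Bicliques in the random graph\<close>

lemma set_pmf_gnpD:
  assumes "G \<in> set_pmf (gnp n p)"
  shows "verts G = {1..n}" "finite_graph G"
  using assms by (auto simp: gnp_def finite_graph_def)

lemma prob_gnp_contains_edges:
  assumes "F \<subseteq> nsets {1..n} 2" "0 \<le> p" "p \<le> 1"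
  shows "measure_pmf.prob (gnp n p) {G. F \<subseteq> edges G} = p ^ card F"
proof -
  let ?E = "nsets {1..n} 2"
  have fin: "finite ?E" by (intro finite_imp_finite_nsets) simp
  have "(\<lambda>X. ({1..n}, {e \<in> ?E. X e})) -` {G. F \<subseteq> edges G}
      = Pi ?E (\<lambda>e. if e \<in> F then {True} else UNIV)"
    using assms(1) by (auto simp: Pi_def split: if_splits)
  then have "measure_pmf.prob (gnp n p) {G. F \<subseteq> edges G}
      = (\<Prod>e\<in>?E. measure_pmf.prob (bernoulli_pmf p) (if e \<in> F then {True} else UNIV))"
    unfolding gnp_def measure_map_pmf by (simp only: measure_Pi_pmf_Pi[OF fin])
  also have "\<dots> = (\<Prod>e\<in>?E. if e \<in> F then p else 1)"
    using assms(2,3) by (intro prod.cong) (auto simp: measure_pmf_single)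
  also have "\<dots> = p ^ card F"
    using fin assms(1) by (simp add: prod.If_cases Int_absorb1)
  finally show ?thesis .
qed

lemma prob_gnp_contains_biclique:
  assumes "X \<subseteq> {1..n}" "Y \<subseteq> {1..n}" "X \<inter> Y = {}" "0 \<le> p" "p \<le> 1"
  shows "measure_pmf.prob (gnp n p) {G. biclique_edges X Y \<subseteq> edges G} = p ^ (card X * card Y)"
proof -
  have "inj_on (\<lambda>(x, y). {x, y}) (X \<times> Y)"
    using assms(3) by (auto simp: inj_on_def doubleton_eq_iff)
  then have "card (biclique_edges X Y) = card X * card Y"
    by (simp add: biclique_edges_def card_image card_cartesian_product)
  moreover have "biclique_edges X Y \<subseteq> nsets {1..n} 2"
    using assms(1-3) by (auto simp: biclique_edges_def disjoint_iff simp del: atLeastAtMost_iff)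
  ultimately show ?thesis using prob_gnp_contains_edges assms(4,5) by metis
qed

lemma prob_gnp_has_biclique_le:
  assumes p: "0 \<le> p" "p \<le> 1"
  shows "measure_pmf.prob (gnp n p) {G. has_biclique z G} \<le> ((real n)\<^sup>2 * p ^ z) ^ z"
proof -
  let ?sets = "{X. X \<subseteq> {1..n} \<and> card X = z}"
  define Pairs where "Pairs = {(X, Y) \<in> ?sets \<times> ?sets. X \<inter> Y = {}}"
  define Ev where "Ev = (\<lambda>(X, Y). {G :: nat ugraph. biclique_edges X Y \<subseteq> edges G})"
  have finite_Pairs: "finite Pairs"
    by (rule finite_subset[of _ "?sets \<times> ?sets"]) (auto simp: Pairs_def)
  have "card Pairs \<le> card (?sets \<times> ?sets)"
    by (intro card_mono) (auto simp: Pairs_def)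
  also have "\<dots> = (n choose z) * (n choose z)"
    using n_subsets[of "{1..n}" z] by (simp add: card_cartesian_product)
  also have "\<dots> \<le> n ^ z * n ^ z" by (intro mult_le_mono choose_le_power)
  finally have card_Pairs: "real (card Pairs) \<le> real n ^ z * real n ^ z"
    by (simp flip: of_nat_power of_nat_mult)
  have "AE G in gnp n p. has_biclique z G \<longrightarrow> G \<in> \<Union> (Ev ` Pairs)"
    by (auto simp: AE_measure_pmf_iff has_biclique_def Ev_def Pairs_def set_pmf_gnpD(1))
  then have "measure_pmf.prob (gnp n p) {G. has_biclique z G}
      \<le> measure_pmf.prob (gnp n p) (\<Union> (Ev ` Pairs))"
    by (intro measure_pmf.finite_measure_mono_AE) auto
  also have "\<dots> \<le> (\<Sum>\<pi>\<in>Pairs. measure_pmf.prob (gnp n p) (Ev \<pi>))"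
    using finite_Pairs by (intro measure_pmf.finite_measure_subadditive_finite) auto
  also have "\<dots> = (\<Sum>\<pi>\<in>Pairs. p ^ (z * z))"
    using p by (intro sum.cong) (auto simp: Pairs_def Ev_def prob_gnp_contains_biclique)
  also have "\<dots> \<le> real n ^ z * real n ^ z * p ^ (z * z)"
    using card_Pairs p by (simp add: mult_right_mono)
  also have "\<dots> = ((real n)\<^sup>2 * p ^ z) ^ z"
    by (simp add: power_mult power_mult_distrib power2_eq_square)
  finally show ?thesis .
qed

lemma prob_gnp_no_biclique_tendsto_1:
  assumes p: "0 \<le> p" "p \<le> 1" and lim: "(\<lambda>n. (real n)\<^sup>2 * p ^ z n) \<longlonglongrightarrow> 0"
  shows "(\<lambda>n. measure_pmf.prob (gnp n p) {G. \<not> has_biclique (z n) G}) \<longlonglongrightarrow> 1"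
proof -
  define q where "q n = (real n)\<^sup>2 * p ^ z n" for n
  have "\<forall>\<^sub>F n in sequentially. q n < 1"
    using lim unfolding q_def by (rule order_tendstoD) simp
  then have lower: "\<forall>\<^sub>F n in sequentially.
      1 - q n \<le> measure_pmf.prob (gnp n p) {G. \<not> has_biclique (z n) G}"
    using eventually_ge_at_top[of 1]
  proof eventually_elim
    case (elim n)
    have q_nonneg: "0 \<le> q n" using p(1) by (simp add: q_def)
    have "z n \<noteq> 0"
    proof
      assume "z n = 0"
      then show False using elim by (simp add: q_def power2_eq_square flip: of_nat_mult)
    qed
    then have "q n ^ z n \<le> q n ^ 1"
      using elim(1) q_nonneg by (intro power_decreasing) auto
    then have "measure_pmf.prob (gnp n p) {G. has_biclique (z n) G} \<le> q n"
      using prob_gnp_has_biclique_le[OF p, of n "z n"] by (simp add: q_def)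
    moreover have "measure_pmf.prob (gnp n p) {G. \<not> has_biclique (z n) G}
        = 1 - measure_pmf.prob (gnp n p) {G. has_biclique (z n) G}"
      using measure_pmf.prob_compl[of "{G. has_biclique (z n) G}" "gnp n p"]
      by (simp add: Collect_neg_eq Compl_eq_Diff_UNIV)
    ultimately show ?case by linarith
  qed
  have lower_lim: "(\<lambda>n. 1 - q n) \<longlonglongrightarrow> 1"
    using tendsto_diff[OF tendsto_const lim, of 1] by (simp add: q_def)
  show ?thesis
    by (rule tendsto_sandwich[OF lower _ lower_lim tendsto_const]) simp
qed

lemma sq_mult_power_ceiling_powr_tendsto_0:
  fixes p \<delta> :: real
  assumes "0 < p" "p < 1" "0 < \<delta>"
  shows "(\<lambda>n. (real n)\<^sup>2 * p ^ nat \<lceil>real n powr \<delta>\<rceil>) \<longlonglongrightarrow> 0"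
proof -
  define c where "c = - ln p"
  have "0 < c" using assms by (simp add: c_def)
  then have lim: "(\<lambda>n. (real n)\<^sup>2 * exp (- c * real n powr \<delta>)) \<longlonglongrightarrow> 0"
    using assms(3) by real_asymp
  have "p ^ nat \<lceil>real n powr \<delta>\<rceil> \<le> exp (- c * real n powr \<delta>)" for n
  proof -
    have "p ^ nat \<lceil>real n powr \<delta>\<rceil> = exp (- c * nat \<lceil>real n powr \<delta>\<rceil>)"
      unfolding exp_of_nat2_mult c_def using assms(1) by simp
    also have "\<dots> \<le> exp (- c * real n powr \<delta>)"
      using \<open>0 < c\<close> by (simp add: of_nat_ceiling)
    finally show ?thesis .
  qed
  then have "(real n)\<^sup>2 * p ^ nat \<lceil>real n powr \<delta>\<rceil> \<le> (real n)\<^sup>2 * exp (- c * real n powr \<delta>)" for n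
    by (intro mult_left_mono) simp_all
  then show ?thesis
    using assms(1) by (intro tendsto_sandwich[OF _ _ tendsto_const lim]) simp_all
qed

lemma eventually_ceiling_powr_power_le:
  fixes \<delta> \<gamma> :: real
  assumes "0 < \<delta>" "m * \<delta> < \<gamma>"
  shows "\<forall>\<^sub>F n in sequentially. real (nat \<lceil>real n powr \<delta>\<rceil> ^ m) \<le> real n powr \<gamma>"
proof -
  have "filterlim (\<lambda>n. real n powr (\<gamma> - m * \<delta>)) at_top sequentially"
    using assms(2) by real_asymp
  then have "\<forall>\<^sub>F n in sequentially. 2 ^ m \<le> real n powr (\<gamma> - m * \<delta>)"
    by (simp add: filterlim_at_top)
  then show ?thesis
    using eventually_ge_at_top[of 1]
  proof eventually_elim
    case (elim n)
    have "1 \<le> real n powr \<delta>" using elim(2) assms(1) by (simp add: ge_one_powr_ge_zero)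
    then have "real (nat \<lceil>real n powr \<delta>\<rceil>) \<le> 2 * real n powr \<delta>" by linarith
    then have "real (nat \<lceil>real n powr \<delta>\<rceil> ^ m) \<le> (2 * real n powr \<delta>) ^ m"
      unfolding of_nat_power by (rule power_mono) (rule of_nat_0_le_iff)
    also have "\<dots> = 2 ^ m * real n powr (m * \<delta>)"
      using elim(2) by (simp add: power_mult_distrib powr_powr mult.commute flip: powr_realpow)
    also have "\<dots> \<le> real n powr (\<gamma> - m * \<delta>) * real n powr (m * \<delta>)"
      using elim(1) by (intro mult_right_mono) auto
    also have "\<dots> = real n powr \<gamma>" by (simp flip: powr_add)
    finally show ?case .
  qed
qed

lemma le_ceiling_powr_inverse_power:
  assumes "0 < K"
  shows "n \<le> nat \<lceil>real n powr (1 / K)\<rceil> ^ K"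
proof (cases "n = 0")
  case False
  then have "real n = (real n powr (1 / K)) ^ K"
    using assms by (simp add: powr_powr flip: powr_realpow)
  also have "\<dots> \<le> real (nat \<lceil>real n powr (1 / K)\<rceil>) ^ K"
    by (intro power_mono) (auto simp: of_nat_ceiling)
  finally show ?thesis unfolding of_nat_power[symmetric] of_nat_le_iff .
qed (use assms in simp)

lemma eventually_ex_num_le_if_no_biclique:
  fixes L :: "'a ugraph"
  assumes "finite_graph L" "bipartite L"
  shows "\<exists>\<delta>>0. \<exists>\<epsilon>>0. \<forall>\<^sub>F n in sequentially. \<forall>P G. hereditary_property P \<longrightarrow> L \<notin> P \<longrightarrow>
    finite_graph G \<longrightarrow> card (verts G) = n \<longrightarrow> \<not> has_biclique (nat \<lceil>real n powr \<delta>\<rceil>) G \<longrightarrow>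
    ex_num G P \<le> real n powr (2 - \<epsilon>)"
    (is "\<exists>\<delta>>0. \<exists>\<epsilon>>0. \<forall>\<^sub>F n in sequentially. ?bounded \<delta> \<epsilon> n")
proof -
  obtain K z\<^sub>0 where "0 < K" and bound: "\<And>z P G. \<lbrakk>z\<^sub>0 \<le> z; hereditary_property P; L \<notin> P; finite_graph G;
      card (verts G) \<le> z ^ K; \<not> has_biclique z G\<rbrakk> \<Longrightarrow> ex_num G P < z ^ (2 * K - 1)"
    using ex_num_less_if_no_biclique[OF assms] by metis
  define \<delta> \<epsilon> where "\<delta> = 1 / real K" and "\<epsilon> = 1 / real (2 * K)"
  have pos: "0 < \<delta>" "0 < \<epsilon>" using \<open>0 < K\<close> by (simp_all add: \<delta>_def \<epsilon>_def)
  have "\<forall>\<^sub>F n in sequentially. real (nat \<lceil>real n powr \<delta>\<rceil> ^ (2 * K - 1)) \<le> real n powr (2 - \<epsilon>)"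
    using \<open>0 < K\<close> pos(1)
    by (intro eventually_ceiling_powr_power_le) (auto simp: \<delta>_def \<epsilon>_def field_simps of_nat_diff)
  moreover have "filterlim (\<lambda>n. nat \<lceil>real n powr \<delta>\<rceil>) at_top sequentially"
    using pos(1) by real_asymp
  then have "\<forall>\<^sub>F n in sequentially. z\<^sub>0 \<le> nat \<lceil>real n powr \<delta>\<rceil>" by (simp add: filterlim_at_top)
  ultimately have "\<forall>\<^sub>F n in sequentially. ?bounded \<delta> \<epsilon> n"
  proof eventually_elim
    case (elim n)
    show ?case
    proof (intro allI impI)
      fix P and G :: "'a ugraph"
      assume P: "hereditary_property P" "L \<notin> P"
        and G: "finite_graph G" "card (verts G) = n" "\<not> has_biclique (nat \<lceil>real n powr \<delta>\<rceil>) G"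
      have "ex_num G P < nat \<lceil>real n powr \<delta>\<rceil> ^ (2 * K - 1)"
        using elim(2) P G le_ceiling_powr_inverse_power[OF \<open>0 < K\<close>, of n]
        by (intro bound) (simp_all add: \<delta>_def)
      then show "ex_num G P \<le> real n powr (2 - \<epsilon>)"
        using elim(1) by (meson of_nat_le_iff less_imp_le order_trans)
    qed
  qed
  with pos show ?thesis by blast
qed

theorem theorem1p1:
  fixes L :: "nat ugraph"
  assumes "finite_graph L" and "bipartite L"
  shows "\<exists>\<epsilon>>0. \<forall>P :: nat ugraph set. hereditary_property P \<and> L \<notin> P \<longrightarrow>
           (\<forall>p::real. 0 < p \<and> p < 1 \<longrightarrow>
             (\<lambda>n. measure_pmf.prob (gnp n p) {G. real (ex_num G P) \<le> real n powr (2 - \<epsilon>)})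
               \<longlonglongrightarrow> 1)"
proof -
  obtain \<delta> \<epsilon> where pos: "0 < \<delta>" "0 < \<epsilon>" and bound: "\<forall>\<^sub>F n in sequentially. \<forall>P G. hereditary_property P \<longrightarrow>
      L \<notin> P \<longrightarrow> finite_graph G \<longrightarrow> card (verts G) = n \<longrightarrow>
      \<not> has_biclique (nat \<lceil>real n powr \<delta>\<rceil>) G \<longrightarrow> ex_num G P \<le> real n powr (2 - \<epsilon>)"
    using eventually_ex_num_le_if_no_biclique[OF assms] by blast
  have "(\<lambda>n. measure_pmf.prob (gnp n p) {G. real (ex_num G P) \<le> real n powr (2 - \<epsilon>)}) \<longlonglongrightarrow> 1"
    if P: "hereditary_property P \<and> L \<notin> P" and p: "0 < p \<and> p < 1" for P p
  proof (rule tendsto_sandwich)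
    let ?no_biclique = "\<lambda>n. {G. \<not> has_biclique (nat \<lceil>real n powr \<delta>\<rceil>) G}"
    show "(\<lambda>n. measure_pmf.prob (gnp n p) (?no_biclique n)) \<longlonglongrightarrow> 1"
      using p pos(1) by (intro prob_gnp_no_biclique_tendsto_1 sq_mult_power_ceiling_powr_tendsto_0) auto
    show "\<forall>\<^sub>F n in sequentially. measure_pmf.prob (gnp n p) (?no_biclique n)
        \<le> measure_pmf.prob (gnp n p) {G. real (ex_num G P) \<le> real n powr (2 - \<epsilon>)}"
      using bound
    proof eventually_elim
      case (elim n)
      have "ex_num G P \<le> real n powr (2 - \<epsilon>)" if "G \<in> set_pmf (gnp n p)" "G \<in> ?no_biclique n" for G
        using elim[rule_format, of P G] P set_pmf_gnpD[OF that(1)] that(2) by simp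
      then show ?case
        by (intro measure_pmf.finite_measure_mono_AE) (auto simp: AE_measure_pmf_iff)
    qed
  qed (auto intro: tendsto_const)
  with pos(2) show ?thesis by blast
qed

end
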